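(* Let $t$ be a positive integer. There exists an integer $N$ (depending on $t$) such that for all integers $n,m\ge N$ with $n \ge 8(t+1)^2 m$, there exist $t$-IMOLS$(n;m)$, i.e. a set of $t$ mutually orthogonal incomplete latin squares of order $n$ having a common hole of order $m$.
   Context: An incomplete latin square of order $n$ with a hole of order $m$ is an $n\times n$ array $L=(L_{ij}:i,j\in[n])$ on the symbol set $[n]=\{1,\dots,n\}$, together with a set $M\subseteq[n]$ with $|M|=m$, such that: $L_{ij}$ is empty if $\{i,j\}\subseteq M$; $L_{ij}$ contains exactly one symbol if $\{i,j\}\not\subseteq M$; every row and every column contains each symbol at most once; and symbols in $M$ do not appear in rows or columns indexed by $M$. Two incomplete latin squares $L,L'$ of order $n$ with the same hole $M$ are orthogonal if $\{(L_{ij},L'_{ij}):\{i,j\}\not\subseteq M\}=[n]^2\setminus M^2$. A $t$-IMOLS$(n;m)$ is a set of $t$ such incomplete latin squares of order $n$ with a common hole of order $m$ that are pairwise orthogonal. *)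

theory Defs
  imports Main
begin

text \<open>
  Rows, columns and symbols are the elements of \<open>{1..n}\<close>. A cell is \<open>None\<close> if it is
  empty and \<open>Some k\<close> if it contains the symbol \<open>k\<close>. An array is required to be \<open>None\<close>
  outside \<open>{1..n} \<times> {1..n}\<close>, so that two arrays are equal as functions precisely if
  they agree on all cells.
\<close>

type_synonym array = "nat \<Rightarrow> nat \<Rightarrow> nat option"

definition incomplete_latin_square :: "nat \<Rightarrow> nat \<Rightarrow> nat set \<Rightarrow> array \<Rightarrow> bool" where
  "incomplete_latin_square n m M L \<longleftrightarrow>
     M \<subseteq> {1..n} \<and> card M = m \<and>
     (\<forall>i j. \<not> {i, j} \<subseteq> {1..n} \<longrightarrow> L i j = None) \<and>
     (\<forall>i\<in>{1..n}. \<forall>j\<in>{1..n}. {i, j} \<subseteq> M \<longrightarrow> L i j = None) \<and>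
     (\<forall>i\<in>{1..n}. \<forall>j\<in>{1..n}. \<not> {i, j} \<subseteq> M \<longrightarrow> (\<exists>k\<in>{1..n}. L i j = Some k)) \<and>
     (\<forall>i\<in>{1..n}. \<forall>j\<in>{1..n}. \<forall>j'\<in>{1..n}. \<forall>k. L i j = Some k \<and> L i j' = Some k \<longrightarrow> j = j') \<and>
     (\<forall>j\<in>{1..n}. \<forall>i\<in>{1..n}. \<forall>i'\<in>{1..n}. \<forall>k. L i j = Some k \<and> L i' j = Some k \<longrightarrow> i = i') \<and>
     (\<forall>i\<in>{1..n}. \<forall>j\<in>{1..n}. \<forall>k\<in>M. i \<in> M \<or> j \<in> M \<longrightarrow> L i j \<noteq> Some k)"

definition orthogonal_ils :: "nat \<Rightarrow> nat set \<Rightarrow> array \<Rightarrow> array \<Rightarrow> bool" where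
  "orthogonal_ils n M L L' \<longleftrightarrow>
     {(a, b). \<exists>i\<in>{1..n}. \<exists>j\<in>{1..n}. \<not> {i, j} \<subseteq> M \<and> L i j = Some a \<and> L' i j = Some b}
       = {1..n} \<times> {1..n} - M \<times> M"

definition IMOLS :: "nat \<Rightarrow> nat \<Rightarrow> nat \<Rightarrow> array set \<Rightarrow> bool" where
  "IMOLS t n m S \<longleftrightarrow>
     finite S \<and> card S = t \<and>
     (\<exists>M. (\<forall>L\<in>S. incomplete_latin_square n m M L) \<and>
          (\<forall>L\<in>S. \<forall>L'\<in>S. L \<noteq> L' \<longrightarrow> orthogonal_ils n M L L'))"

end

(*
  Inflating a transversal design with g points per group gives t-IMOLS of order m g + h with a
  hole of order h whenever h is a sum of g weights w for which there are t-IMOLS(m + w; w). If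
  t MOLS of order q exist and m = c (q - 1) with c large, the weights 0, 1 and c are available,
  because MOLS of all large orders exist. So t-IMOLS(n; h) exist if n = h (mod m) and n exceeds
  q h by a constant.

  The congruence is removed by composition. With q a power of 2 in [t + 1, 2 (t + 1)), and with
  coprime moduli belonging to q and 2 q, the Chinese remainder theorem provides an order l
  between h and n such that t-IMOLS(n; l) and t-IMOLS(l; h) exist. The loss in the ratio is
  q (2 q) < 8 (t + 1)^2.

  That t MOLS of all large orders exist is the theorem of Chowla, Erdos and Straus. It follows
  from the weights 0 and 1 with m fixed: m and m + 1 are orders built from a power of 2 and a
  number without small prime factors, and n = m g + u with g and u without small prime factors.
*)
theory Submission
  imports
    Defs
    "HOL-Combinatorics.Transposition"
    "HOL-Library.Z2"
    "HOL-Number_Theory.Cong"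
    "HOL-Algebra.Algebraic_Closure_Type"
begin

hide_const (open) Divisibility.prime
no_notation Polynomials.var (\<open>X\<index>\<close>)
no_notation set_add (infixl \<open><+>\<index>\<close> 60)
notation Sum_Type.Plus (infixr \<open><+>\<close> 65)

section \<open>Incomplete transversal designs\<close>

text \<open>
  Incomplete transversal designs in the form of orthogonal arrays: \<open>I\<close> is the set of rows
  (blocks), the \<open>i\<close>-th group is a copy of \<open>X\<close>, and \<open>f r i\<close> is the point of the block \<open>r\<close>
  in the \<open>i\<close>-th group. The hole is \<open>H\<close>. For \<open>k = t + 2\<close> these encode \<open>t\<close>-IMOLS: the first
  two columns are the coordinates of a cell and the others the entries of the squares.
\<close>

definition ITD :: "nat \<Rightarrow> 'a set \<Rightarrow> 'a set \<Rightarrow> 'i set \<Rightarrow> ('i \<Rightarrow> nat \<Rightarrow> 'a) \<Rightarrow> bool" where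
  "ITD k X H I f \<longleftrightarrow>
     (\<forall>i<k. \<forall>j<k. i \<noteq> j \<longrightarrow> bij_betw (\<lambda>r. (f r i, f r j)) I (X \<times> X - H \<times> H))"

lemma ITD_I:
  assumes "\<And>r i j. r \<in> I \<Longrightarrow> i < k \<Longrightarrow> j < k \<Longrightarrow> i \<noteq> j \<Longrightarrow> (f r i, f r j) \<in> X \<times> X - H \<times> H"
    and "\<And>x y i j. i < k \<Longrightarrow> j < k \<Longrightarrow> i \<noteq> j \<Longrightarrow> (x, y) \<in> X \<times> X - H \<times> H \<Longrightarrow>
           \<exists>r\<in>I. f r i = x \<and> f r j = y"
    and "\<And>r s i j. i < k \<Longrightarrow> j < k \<Longrightarrow> i \<noteq> j \<Longrightarrow> r \<in> I \<Longrightarrow> s \<in> I \<Longrightarrow>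
           f r i = f s i \<Longrightarrow> f r j = f s j \<Longrightarrow> r = s"
  shows "ITD k X H I f"
  unfolding ITD_def bij_betw_def
proof (intro allI impI conjI)
  fix i j assume ij: "i < k" "j < k" "i \<noteq> j"
  show "inj_on (\<lambda>r. (f r i, f r j)) I"
    using assms(3)[OF ij] by (auto intro!: inj_onI)
  show "(\<lambda>r. (f r i, f r j)) ` I = X \<times> X - H \<times> H"
  proof (intro equalityI subsetI)
    fix p assume "p \<in> (\<lambda>r. (f r i, f r j)) ` I"
    then obtain r where "r \<in> I" "p = (f r i, f r j)" by auto
    thus "p \<in> X \<times> X - H \<times> H" using assms(1)[OF _ ij] by simp
  next
    fix p assume p: "p \<in> X \<times> X - H \<times> H"
    obtain x y where "p = (x, y)" by (cases p)
    with p assms(2)[OF ij, of x y] show "p \<in> (\<lambda>r. (f r i, f r j)) ` I" by auto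
  qed
qed

lemma ITD_mem:
  assumes "ITD k X H I f" "r \<in> I" "i < k" "j < k" "i \<noteq> j"
  shows "(f r i, f r j) \<in> X \<times> X - H \<times> H"
proof -
  have "bij_betw (\<lambda>r. (f r i, f r j)) I (X \<times> X - H \<times> H)" using assms unfolding ITD_def by simp
  from bij_betwE[OF this] \<open>r \<in> I\<close> show ?thesis by simp
qed

lemma ITD_mem1:
  assumes "ITD k X H I f" "r \<in> I" "i < k" "2 \<le> k"
  shows "f r i \<in> X"
proof -
  let ?j = "if i = 0 then 1 else 0"
  have "?j < k" "i \<noteq> ?j" using \<open>2 \<le> k\<close> by auto
  from ITD_mem[OF assms(1-3) this] show ?thesis by simp
qed

lemma ITD_ex:
  assumes "ITD k X H I f" "i < k" "j < k" "i \<noteq> j" "(x, y) \<in> X \<times> X - H \<times> H"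
  obtains r where "r \<in> I" "f r i = x" "f r j = y"
proof -
  have "(x, y) \<in> (\<lambda>r. (f r i, f r j)) ` I"
    using assms unfolding ITD_def bij_betw_def by simp
  then obtain r where "r \<in> I" "(x, y) = (f r i, f r j)" by (rule imageE)
  thus ?thesis using that[of r] by simp
qed

lemma ITD_uniq:
  assumes "ITD k X H I f" "i < k" "j < k" "i \<noteq> j" "r \<in> I" "s \<in> I" "f r i = f s i" "f r j = f s j"
  shows "r = s"
proof -
  have "inj_on (\<lambda>r. (f r i, f r j)) I"
    using assms(1-4) unfolding ITD_def bij_betw_def by simp
  from inj_onD[OF this, of r s] show ?thesis using assms by simp
qed

section \<open>Renaming of points and blocks\<close>

text \<open>The product of \<open>g i\<close> and \<open>g j\<close> carries the required pairs onto
  the required pairs. The map may vary with the group, and \<open>itd_hole_1\<close> uses this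
  freedom.\<close>

lemma ITD_relabel:
  assumes A: "ITD k X H I f"
    and g: "\<And>i. i < k \<Longrightarrow> bij_betw (g i) X Y" "\<And>i. i < k \<Longrightarrow> g i ` H = G" and HX: "H \<subseteq> X"
    and k: "2 \<le> k"
  shows "ITD k Y G I (\<lambda>r i. g i (f r i))"
proof -
  have inj: "inj_on (g i) X" and im: "g i ` X = Y" if "i < k" for i
    using g(1)[OF that] by (auto simp: bij_betw_def)
  have Giff: "g i x \<in> G \<longleftrightarrow> x \<in> H" if "i < k" "x \<in> X" for i x
    using inj_on_image_mem_iff[OF inj[OF that(1)] that(2) HX] g(2)[OF that(1)] by simp
  show ?thesis
  proof (rule ITD_I)
    fix r i j assume "r \<in> I" "i < k" "j < k" "i \<noteq> j"
    with ITD_mem[OF A this] show "(g i (f r i), g j (f r j)) \<in> Y \<times> Y - G \<times> G"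
      using Giff im by blast
  next
    fix x y i j assume ij: "i < k" "j < k" "i \<noteq> j" and xy: "(x, y) \<in> Y \<times> Y - G \<times> G"
    obtain x' where x': "x' \<in> X" "g i x' = x" using xy im[OF ij(1)] by auto
    obtain y' where y': "y' \<in> X" "g j y' = y" using xy im[OF ij(2)] by auto
    have "(x', y') \<in> X \<times> X - H \<times> H" using xy x' y' Giff ij by auto
    then obtain r where "r \<in> I" "f r i = x'" "f r j = y'" using ITD_ex[OF A ij] by blast
    thus "\<exists>r\<in>I. g i (f r i) = x \<and> g j (f r j) = y" using x' y' by auto
  next
    fix r s i j assume ij: "i < k" "j < k" "i \<noteq> j" and rs: "r \<in> I" "s \<in> I"
      and e: "g i (f r i) = g i (f s i)" "g j (f r j) = g j (f s j)"
    have "f r i = f s i" using e(1) inj[OF ij(1)] ITD_mem1[OF A _ ij(1) k] rs by (auto dest: inj_onD)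
    moreover have "f r j = f s j" using e(2) inj[OF ij(2)] ITD_mem1[OF A _ ij(2) k] rs by (auto dest: inj_onD)
    ultimately show "r = s" using ITD_uniq[OF A ij rs] by blast
  qed
qed

lemma ITD_reindex:
  assumes A: "ITD k X H I f" and b: "bij_betw p J I"
  shows "ITD k X H J (\<lambda>r. f (p r))"
  unfolding ITD_def
proof (intro allI impI)
  fix i j assume "i < k" "j < k" "i \<noteq> j"
  hence "bij_betw (\<lambda>r. (f r i, f r j)) I (X \<times> X - H \<times> H)" using A unfolding ITD_def by blast
  from bij_betw_trans[OF b this] show "bij_betw (\<lambda>r. (f (p r) i, f (p r) j)) J (X \<times> X - H \<times> H)"
    by (simp add: comp_def)
qed

text \<open>A type of blocks cannot be quantified inside a definition. The type
  \<open>nat * nat\<close> is general enough, since for \<open>2 <= k\<close> a block is determined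
  by its first two points.\<close>

definition itd :: "nat \<Rightarrow> nat \<Rightarrow> nat \<Rightarrow> bool" where
  "itd k n h \<longleftrightarrow> h \<le> n \<and> (\<exists>(I :: (nat \<times> nat) set) f. ITD k {..<n} {..<h} I f)"

lemma ex_bij_betw_pair:
  assumes "finite X" "H \<subseteq> X" "finite Y" "G \<subseteq> Y" "card X = card Y" "card H = card G"
  obtains g where "bij_betw g X Y" "g ` H = G"
proof -
  have fin: "finite H" "finite G" using assms finite_subset by auto
  obtain a where a: "bij_betw a H G" using fin assms finite_same_card_bij by blast
  have "card (X - H) = card (Y - G)" using assms fin by (simp add: card_Diff_subset)
  then obtain b where b: "bij_betw b (X - H) (Y - G)" using assms finite_same_card_bij by blast
  let ?g = "\<lambda>x. if x \<in> H then a x else b x"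
  have "bij_betw ?g H G" using a by (subst bij_betw_cong[where g = a]) auto
  moreover have "bij_betw ?g (X - H) (Y - G)" using b by (subst bij_betw_cong[where g = b]) auto
  ultimately have "bij_betw ?g (H \<union> (X - H)) (G \<union> (Y - G))" by (rule bij_betw_combine) auto
  hence "bij_betw ?g X Y" using assms by (simp add: Un_absorb1)
  moreover have "?g ` H = G" using \<open>bij_betw ?g H G\<close> by (simp add: bij_betw_def)
  ultimately show ?thesis by (rule that)
qed

text \<open>Each block is renamed to its pair of points in groups 0 and 1; this brings an arbitrary
  block type into the form demanded by \<open>itd\<close>.\<close>

lemma itd_I:
  assumes A: "ITD k X H I f" and "finite X" "H \<subseteq> X" and k: "2 \<le> k"
  shows "itd k (card X) (card H)"
proof -
  have le: "card H \<le> card X" using assms by (simp add: card_mono)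
  obtain g where g: "bij_betw g X {..<card X}" "g ` H = {..<card H}"
    using ex_bij_betw_pair[of X H "{..<card X}" "{..<card H}"] assms le by auto
  have B: "ITD k {..<card X} {..<card H} I (\<lambda>r i. g (f r i))"
    by (rule ITD_relabel[OF A]) (use g assms in auto)
  have "bij_betw (\<lambda>r. (g (f r 0), g (f r 1))) I ({..<card X} \<times> {..<card X} - {..<card H} \<times> {..<card H})"
    using B k unfolding ITD_def by auto
  from ITD_reindex[OF B bij_betw_inv_into[OF this]] show ?thesis
    unfolding itd_def using le by blast
qed

lemma itd_on:
  assumes "itd k n h" "finite X" "H \<subseteq> X" "card X = n" "card H = h" "2 \<le> k"
  obtains I :: "(nat \<times> nat) set" and f where "ITD k X H I f"
proof -
  obtain I :: "(nat \<times> nat) set" and f where A: "ITD k {..<n} {..<h} I f" "h \<le> n"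
    using assms unfolding itd_def by blast
  obtain g where g: "bij_betw g {..<n} X" "g ` {..<h} = H"
    using ex_bij_betw_pair[of "{..<n}" "{..<h}" X H] assms A by auto
  have "ITD k X H I (\<lambda>r i. g (f r i))"
    by (rule ITD_relabel[OF A(1)]) (use g assms A in auto)
  thus ?thesis by (rule that)
qed

section \<open>Filling, products, deletion of a block, and inflation\<close>

text \<open>The second design lives on the hole of the first and covers exactly the pairs left open
  there, except those inside the smaller hole.\<close>

lemma itd_fill:
  assumes "itd k n h" "itd k h l" and k: "2 \<le> k"
  shows "itd k n l"
proof -
  have hn: "h \<le> n" "l \<le> h" using assms by (auto simp: itd_def)
  obtain I :: "(nat \<times> nat) set" and f where A: "ITD k {..<n} {..<h} I f"
    using assms by (auto simp: itd_def)
  obtain J :: "(nat \<times> nat) set" and f' where B: "ITD k {..<h} {..<l} J f'"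
    using assms by (auto simp: itd_def)
  have "ITD k {..<n} {..<l} (I <+> J) (case_sum f f')"
  proof (rule ITD_I, goal_cases)
    case (1 r i j)
    show ?case
    proof (cases r)
      case (Inl a)
      with 1 have "a \<in> I" by auto
      from ITD_mem[OF A this 1(2-4)] show ?thesis using Inl hn by auto
    next
      case (Inr a)
      with 1 have "a \<in> J" by auto
      from ITD_mem[OF B this 1(2-4)] show ?thesis using Inr hn by auto
    qed
  next
    case (2 x y i j)
    show ?case
    proof (cases "x < h \<and> y < h")
      case True
      with 2 obtain r where "r \<in> J" "f' r i = x" "f' r j = y"
        using ITD_ex[OF B 2(1-3), of x y] by auto
      then show ?thesis by (intro bexI[of _ "Inr r"]) auto
    next
      case False
      with 2 obtain r where "r \<in> I" "f r i = x" "f r j = y"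
        using ITD_ex[OF A 2(1-3), of x y] by auto
      then show ?thesis by (intro bexI[of _ "Inl r"]) auto
    qed
  next
    case (3 r s i j)
    have apart: "\<not> (f a i = f' b i \<and> f a j = f' b j)" if "a \<in> I" "b \<in> J" for a b
      using ITD_mem[OF A that(1) 3(1-3)] ITD_mem[OF B that(2) 3(1-3)] by auto
    show ?case
    proof (cases r; cases s)
      fix a b assume "r = Inl a" "s = Inl b"
      with 3 show ?thesis using ITD_uniq[OF A 3(1-3), of a b] by auto
    next
      fix a b assume "r = Inr a" "s = Inr b"
      with 3 show ?thesis using ITD_uniq[OF B 3(1-3), of a b] by auto
    next
      fix a b assume "r = Inl a" "s = Inr b"
      with 3 show ?thesis using apart[of a b] by auto
    next
      fix a b assume "r = Inr a" "s = Inl b"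
      with 3 show ?thesis using apart[of b a] by auto
    qed
  qed
  from itd_I[OF this] show ?thesis using hn k by simp
qed

text \<open>Direct product of blocks: as the second design has no hole, a pair of points is left
  open iff both first coordinates lie in the hole of the first design.\<close>

lemma itd_product:
  assumes "itd k n h" "itd k m 0" and k: "2 \<le> k"
  shows "itd k (n * m) (h * m)"
proof -
  have hn: "h \<le> n" using assms by (auto simp: itd_def)
  obtain I :: "(nat \<times> nat) set" and f where A: "ITD k {..<n} {..<h} I f"
    using assms by (auto simp: itd_def)
  obtain J :: "(nat \<times> nat) set" and f' where B: "ITD k {..<m} {..<0} J f'"
    using assms by (auto simp: itd_def)
  have "ITD k ({..<n} \<times> {..<m}) ({..<h} \<times> {..<m}) (I \<times> J) (\<lambda>(r, s) i. (f r i, f' s i))"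
  proof (rule ITD_I, goal_cases)
    case (1 r i j)
    then obtain a b where ab: "r = (a, b)" "a \<in> I" "b \<in> J" by auto
    show ?case using ITD_mem[OF A ab(2) 1(2-4)] ITD_mem[OF B ab(3) 1(2-4)] ab by auto
  next
    case (2 x y i j)
    obtain a b c d where xy: "x = (a, b)" "y = (c, d)" by (cases x, cases y)
    have 3: "(a, c) \<in> {..<n} \<times> {..<n} - {..<h} \<times> {..<h}" "(b, d) \<in> {..<m} \<times> {..<m} - {..<0} \<times> {..<0}"
      using 2(4) xy by auto
    obtain r where r: "r \<in> I" "f r i = a" "f r j = c" using ITD_ex[OF A 2(1-3) 3(1)] .
    obtain s where s: "s \<in> J" "f' s i = b" "f' s j = d" using ITD_ex[OF B 2(1-3) 3(2)] .
    show ?case using r s xy by (intro bexI[of _ "(r, s)"]) auto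
  next
    case (3 r s i j)
    then show ?case using ITD_uniq[OF A 3(1-3)] ITD_uniq[OF B 3(1-3)] by auto
  qed
  from itd_I[OF this] show ?thesis using hn k by (simp add: Sigma_mono card_cartesian_product)
qed

text \<open>Relabelling each group separately turns one block \<open>r0\<close> into the constant
  block 0. Deleting it leaves exactly the pair (0, 0) uncovered in any two groups.\<close>

lemma itd_hole_1:
  assumes "itd k n 0" "0 < n" and k: "2 \<le> k"
  shows "itd k n 1"
proof -
  obtain I :: "(nat \<times> nat) set" and f where A: "ITD k {..<n} {} I f"
    using assms by (auto simp: itd_def)
  obtain r0 where r0: "r0 \<in> I"
    by (rule ITD_ex[OF A, of 0 1 0 0]) (use k \<open>0 < n\<close> in auto)
  define g where "g i = transpose (f r0 i) 0" for i
  have B: "ITD k {..<n} {} I (\<lambda>r i. g i (f r i))"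
  proof (rule ITD_relabel[OF A])
    fix i assume "i < k"
    hence "f r0 i < n" using ITD_mem1[OF A r0 _ k] by auto
    thus "bij_betw (g i) {..<n} {..<n}" unfolding g_def using \<open>0 < n\<close>
      by (intro bij_betw_byWitness[where f' = "transpose (f r0 i) 0"]) (auto simp: transpose_def)
  qed (use k in auto)
  define e where "e = (\<lambda>r i. g i (f r i))"
  have B': "ITD k {..<n} {} I e" using B unfolding e_def .
  have e0: "e r0 i = 0" for i unfolding e_def g_def by (rule transpose_apply_first)
  have "ITD k {..<n} {0} (I - {r0}) e"
  proof (rule ITD_I, goal_cases)
    case (1 r i j)
    hence "r \<in> I" "r \<noteq> r0" by auto
    have "\<not> (e r i = 0 \<and> e r j = 0)"
      using ITD_uniq[OF B' 1(2-4) \<open>r \<in> I\<close> r0] \<open>r \<noteq> r0\<close> unfolding e0 by blast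
    then show ?case using ITD_mem[OF B' \<open>r \<in> I\<close> 1(2-4)] by blast
  next
    case (2 x y i j)
    hence "(x, y) \<in> {..<n} \<times> {..<n} - {} \<times> {}" by auto
    then obtain r where r: "r \<in> I" "e r i = x" "e r j = y" using ITD_ex[OF B' 2(1-3)] by blast
    moreover have "r \<noteq> r0" using r 2(4) e0 by auto
    ultimately show ?case by blast
  next
    case (3 r s i j)
    then show ?case using ITD_uniq[OF B' 3(1-3)] by blast
  qed
  hence "itd k (card {..<n}) (card {0::nat})"
    by (rule itd_I) (use \<open>0 < n\<close> k in auto)
  thus ?thesis by simp
qed

text \<open>
  Wilson's construction: the points of the first \<open>k\<close> groups of a transversal design on
  \<open>Suc k\<close> groups are inflated \<open>m\<close> times, a point \<open>z\<close> of the last group is replaced by \<open>w z\<close>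
  points, and these together form the hole.
\<close>

lemma itd_wilson:
  assumes TD: "itd (Suc k) g 0" and w: "\<And>z. z < g \<Longrightarrow> itd k (m + w z) (w z)" and k: "2 \<le> k"
  shows "itd k (m * g + (\<Sum>z<g. w z)) (\<Sum>z<g. w z)"
proof -
  obtain I :: "(nat \<times> nat) set" and f where A: "ITD (Suc k) {..<g} {} I f"
    using TD by (auto simp: itd_def)
  have fr: "f r i < g" if "r \<in> I" "i \<le> k" for r i
    using ITD_mem1[OF A that(1), of i] that k by simp
  have "\<forall>z\<in>{..<g}. \<exists>p :: (nat \<times> nat) set \<times> (nat \<times> nat \<Rightarrow> nat \<Rightarrow> nat + nat).
          ITD k ({..<m} <+> {..<w z}) (Inr ` {..<w z}) (fst p) (snd p)"
  proof
    fix z assume "z \<in> {..<g}"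
    hence "itd k (m + w z) (w z)" using w by simp
    then obtain J :: "(nat \<times> nat) set" and e where "ITD k ({..<m} <+> {..<w z}) (Inr ` {..<w z}) J e"
      by (rule itd_on[where X = "{..<m} <+> {..<w z}" and H = "Inr ` {..<w z}"])
        (use k in \<open>auto simp: card_Plus card_image\<close>)
    thus "\<exists>p :: (nat \<times> nat) set \<times> (nat \<times> nat \<Rightarrow> nat \<Rightarrow> nat + nat).
          ITD k ({..<m} <+> {..<w z}) (Inr ` {..<w z}) (fst p) (snd p)"
      by (intro exI[of _ "(J, e)"]) simp
  qed
  from bchoice[OF this] obtain P :: "nat \<Rightarrow> (nat \<times> nat) set \<times> (nat \<times> nat \<Rightarrow> nat \<Rightarrow> nat + nat)"
    where P: "\<forall>z\<in>{..<g}. ITD k ({..<m} <+> {..<w z}) (Inr ` {..<w z}) (fst (P z)) (snd (P z))" ..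
  define J where "J z = fst (P z)" for z
  define e where "e z = snd (P z)" for z
  have B: "ITD k ({..<m} <+> {..<w z}) (Inr ` {..<w z}) (J z) (e z)" if "z < g" for z
    using P that by (simp add: J_def e_def)
  \<comment> \<open>For a block of the outer design with point \<open>a\<close> in the current group
    and \<open>z\<close> in the last one, the ingredient of order \<open>m + w z\<close> is placed
    on the \<open>m\<close> copies of \<open>a\<close> and the \<open>w z\<close> points that
    replace \<open>z\<close>. The latter form its hole.\<close>
  define lab :: "nat \<Rightarrow> nat \<Rightarrow> nat + nat \<Rightarrow> nat \<times> nat + nat \<times> nat"
    where "lab a z p = (case p of Inl s \<Rightarrow> Inl (a, s) | Inr s \<Rightarrow> Inr (z, s))" for a z p
  have lab_simps [simp]: "lab a z (Inl s) = Inl (a, s)" "lab a z (Inr s) = Inr (z, s)" for a z s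
    by (simp_all add: lab_def)
  have lab_inj: "p = q" if "lab a z p = lab a z q" for a z p q
    using that by (cases p; cases q) auto
  define W where "W = (SIGMA z:{..<g}. {..<w z})"
  define X where "X = ({..<g} \<times> {..<m}) <+> W"
  have X_iff [simp]: "Inl (a, s) \<in> X \<longleftrightarrow> a < g \<and> s < m" "Inr q \<in> X \<longleftrightarrow> q \<in> W" for a s q
    by (auto simp: X_def)
  have W_iff [simp]: "(z, s) \<in> W \<longleftrightarrow> z < g \<and> s < w z" for z s by (auto simp: W_def)
  define F where "F = (\<lambda>(r, s) i. lab (f r i) (f r k) (e (f r k) s i))"
  have F_simp: "F (r, s) i = lab (f r i) (f r k) (e (f r k) s i)" for r s i
    by (simp add: F_def)
  have "ITD k X (Inr ` W) (SIGMA r:I. J (f r k)) F"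
  proof (rule ITD_I, goal_cases)
    case (1 p i j)
    then obtain r s where p: "p = (r, s)" "r \<in> I" "s \<in> J (f r k)" by auto
    have z: "f r k < g" and a: "f r i < g" "f r j < g" using fr p 1 by auto
    have "(e (f r k) s i, e (f r k) s j) \<in> ({..<m} <+> {..<w (f r k)}) \<times> ({..<m} <+> {..<w (f r k)})
             - Inr ` {..<w (f r k)} \<times> Inr ` {..<w (f r k)}"
      using ITD_mem[OF B[OF z] p(3) 1(2-4)] .
    thus ?case unfolding p(1) F_simp using z a by auto
  next
    case (2 x y i j)
    have *: "\<exists>p\<in>SIGMA r:I. J (f r k). F p i = lab (f r i) (f r k) u \<and> F p j = lab (f r j) (f r k) v"
      if r: "r \<in> I" and uv: "(u, v) \<in> ({..<m} <+> {..<w (f r k)}) \<times> ({..<m} <+> {..<w (f r k)})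
             - Inr ` {..<w (f r k)} \<times> Inr ` {..<w (f r k)}" for r u v
    proof -
      have "f r k < g" using fr r by simp
      from ITD_ex[OF B[OF this] 2(1-3) uv] obtain s
        where "s \<in> J (f r k)" "e (f r k) s i = u" "e (f r k) s j = v" .
      thus ?thesis using r by (intro bexI[of _ "(r, s)"]) (auto simp: F_simp)
    qed
    \<comment> \<open>Two points of the hole need not be joined. Otherwise the two points prescribe
      two coordinates of the outer block, one of which may be that of the last group
      \<open>k\<close>.\<close>
    consider (LL) a s b t where "x = Inl (a, s)" "y = Inl (b, t)"
      | (LR) a s z t where "x = Inl (a, s)" "y = Inr (z, t)"
      | (RL) z s b t where "x = Inr (z, s)" "y = Inl (b, t)"
      using 2(4) by (cases x; cases y) force+
    then show ?case
    proof cases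
      case LL
      have "(a, b) \<in> {..<g} \<times> {..<g} - {} \<times> {}" using 2(4) LL by auto
      then obtain r where "r \<in> I" "f r i = a" "f r j = b"
        using ITD_ex[OF A, of i j a b] 2(1-3) by auto
      then show ?thesis using *[of r "Inl s" "Inl t"] 2(4) LL by auto
    next
      case LR
      have "(a, z) \<in> {..<g} \<times> {..<g} - {} \<times> {}" using 2(4) LR by auto
      then obtain r where "r \<in> I" "f r i = a" "f r k = z"
        using ITD_ex[OF A, of i k a z] 2(1-3) by auto
      then show ?thesis using *[of r "Inl s" "Inr t"] 2(4) LR by auto
    next
      case RL
      have "(b, z) \<in> {..<g} \<times> {..<g} - {} \<times> {}" using 2(4) RL by auto
      then obtain r where "r \<in> I" "f r j = b" "f r k = z"
        using ITD_ex[OF A, of j k b z] 2(1-3) by auto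
      then show ?thesis using *[of r "Inr s" "Inl t"] 2(4) RL by auto
    qed
  next
    case (3 p q i j)
    obtain r s where p: "p = (r, s)" "r \<in> I" "s \<in> J (f r k)" using 3(4) by auto
    obtain r' s' where q: "q = (r', s')" "r' \<in> I" "s' \<in> J (f r' k)" using 3(5) by auto
    have z: "f r k < g" using fr p by simp
    have eq: "lab (f r i) (f r k) (e (f r k) s i) = lab (f r' i) (f r' k) (e (f r' k) s' i)"
      "lab (f r j) (f r k) (e (f r k) s j) = lab (f r' j) (f r' k) (e (f r' k) s' j)"
      using 3(6,7) unfolding p(1) q(1) F_simp .
    have mem: "(e (f r k) s i, e (f r k) s j) \<in> ({..<m} <+> {..<w (f r k)}) \<times> ({..<m} <+> {..<w (f r k)})
             - Inr ` {..<w (f r k)} \<times> Inr ` {..<w (f r k)}"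
      using ITD_mem[OF B[OF z] p(3) 3(1-3)] .
    have labL: "a = a'" if "lab a z (Inl u) = lab a' z' v" for a z u a' z' v
      using that by (cases v) auto
    have labR: "z = z'" if "lab a z (Inr u) = lab a' z' v" for a z u a' z' v
      using that by (cases v) auto
    \<comment> \<open>At least one of the two points lies outside the hole, so equal labels reveal
      two of the coordinates \<open>i\<close>, \<open>j\<close>, \<open>k\<close> of the outer
      block.\<close>
    have "r = r'"
    proof (cases "e (f r k) s i")
      case ei: (Inl u)
      have i: "f r i = f r' i" using eq(1) unfolding ei by (rule labL)
      show ?thesis
      proof (cases "e (f r k) s j")
        case ej: (Inl v)
        have "f r j = f r' j" using eq(2) unfolding ej by (rule labL)
        with i show ?thesis using ITD_uniq[OF A, of i j r r'] 3(1-3) p(2) q(2) by simp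
      next
        case ej: (Inr v)
        have "f r k = f r' k" using eq(2) unfolding ej by (rule labR)
        with i show ?thesis using ITD_uniq[OF A, of i k r r'] 3(1-3) p(2) q(2) by simp
      qed
    next
      case ei: (Inr u)
      have zz: "f r k = f r' k" using eq(1) unfolding ei by (rule labR)
      obtain v where ej: "e (f r k) s j = Inl v"
        using mem ei by (cases "e (f r k) s j") auto
      have "f r j = f r' j" using eq(2) unfolding ej by (rule labL)
      with zz show ?thesis using ITD_uniq[OF A, of j k r r'] 3(1-3) p(2) q(2) by simp
    qed
    moreover have "s = s'"
      using ITD_uniq[OF B[OF z] 3(1-3) p(3), of s'] q(3) lab_inj[OF eq(1)[folded \<open>r = r'\<close>]]
        lab_inj[OF eq(2)[folded \<open>r = r'\<close>]] unfolding \<open>r = r'\<close> by simp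
    ultimately show ?case using p q by simp
  qed
  moreover have "finite X" by (simp add: X_def W_def)
  moreover have "Inr ` W \<subseteq> X" by (auto simp: X_def)
  ultimately have "itd k (card X) (card (Inr ` W :: (nat \<times> nat + nat \<times> nat) set))"
    using k by (rule itd_I)
  moreover have "card W = (\<Sum>z<g. w z)" by (simp add: W_def card_SigmaI)
  moreover have "finite W" by (simp add: W_def)
  ultimately show ?thesis by (simp add: X_def card_Plus card_image card_cartesian_product mult.commute)
qed

section \<open>From designs to latin squares\<close>

lemma IMOLS_if_itd:
  assumes itd: "itd (t + 2) n m" and mn: "m < n" and n2: "2 \<le> n"
  shows "\<exists>S. IMOLS t n m S"
proof -
  obtain I :: "(nat \<times> nat) set" and f where A: "ITD (t + 2) {1..n} {1..m} I f"
    by (rule itd_on[OF itd, of "{1..n}" "{1..m}"]) (use mn in auto)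
  define X where "X = {1..n}"
  define M where "M = {1..m}"
  define blk where "blk i j = (THE r. r \<in> I \<and> f r 0 = i \<and> f r 1 = j)" for i j
  define L :: "nat \<Rightarrow> array" where
    "L s i j = (if (i, j) \<in> X \<times> X - M \<times> M then Some (f (blk i j) (s + 2)) else None)" for s i j
  have A: "ITD (t + 2) X M I f" using A unfolding X_def M_def .
  have blk: "blk i j \<in> I" "f (blk i j) 0 = i" "f (blk i j) 1 = j" if ij: "(i, j) \<in> X \<times> X - M \<times> M" for i j
  proof -
    obtain r where r: "r \<in> I" "f r 0 = i" "f r 1 = j"
      using ITD_ex[OF A _ _ _ ij, of 0 1] by auto
    have "blk i j = r" unfolding blk_def
      by (rule the_equality) (use r ITD_uniq[OF A, of 0 1] in auto)
    thus "blk i j \<in> I" "f (blk i j) 0 = i" "f (blk i j) 1 = j" using r by auto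
  qed
  have blkI: "blk (f r 0) (f r 1) = r" if "r \<in> I" for r unfolding blk_def
    by (rule the_equality) (use that ITD_uniq[OF A, of 0 1] in auto)
  \<comment> \<open>Every remaining property now concerns blocks and a pair of groups: 0 and
    \<open>s + 2\<close> for rows, 1 and \<open>s + 2\<close> for columns, \<open>s + 2\<close> and
    \<open>s' + 2\<close> for orthogonality.\<close>
  have cell: "L s i j = Some a \<longleftrightarrow> (\<exists>r\<in>I. f r 0 = i \<and> f r 1 = j \<and> f r (s + 2) = a)" for s i j a
  proof
    assume "L s i j = Some a"
    hence "(i, j) \<in> X \<times> X - M \<times> M" "f (blk i j) (s + 2) = a" by (auto simp: L_def split: if_splits)
    with blk show "\<exists>r\<in>I. f r 0 = i \<and> f r 1 = j \<and> f r (s + 2) = a" by (intro bexI[of _ "blk i j"]) auto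
  next
    assume "\<exists>r\<in>I. f r 0 = i \<and> f r 1 = j \<and> f r (s + 2) = a"
    then obtain r where r: "r \<in> I" "f r 0 = i" "f r 1 = j" "f r (s + 2) = a" by auto
    have "(i, j) \<in> X \<times> X - M \<times> M" using ITD_mem[OF A r(1), of 0 1] r by simp
    thus "L s i j = Some a" using blkI[OF r(1)] r by (simp add: L_def)
  qed
  have ils: "incomplete_latin_square n m M (L s)" if s: "s < t" for s
    unfolding incomplete_latin_square_def X_def[symmetric]
  proof (intro conjI allI ballI impI)
    show "M \<subseteq> X" "card M = m" using mn by (auto simp: M_def X_def)
    show "L s i j = None" if "\<not> {i, j} \<subseteq> X" for i j using that by (auto simp: L_def)
    show "L s i j = None" if "{i, j} \<subseteq> M" for i j using that by (auto simp: L_def)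
    show "\<exists>k\<in>X. L s i j = Some k" if "i \<in> X" "j \<in> X" "\<not> {i, j} \<subseteq> M" for i j
    proof -
      have ij: "(i, j) \<in> X \<times> X - M \<times> M" using that by auto
      have "f (blk i j) (s + 2) \<in> X" using ITD_mem1[OF A blk(1)[OF ij], of "s + 2"] s by simp
      thus ?thesis using ij by (simp add: L_def)
    qed
    show "j = j'" if "L s i j = Some k \<and> L s i j' = Some k" for i j j' k
    proof -
      from that obtain r r' where r: "r \<in> I" "f r 0 = i" "f r 1 = j" "f r (s + 2) = k"
        and r': "r' \<in> I" "f r' 0 = i" "f r' 1 = j'" "f r' (s + 2) = k" unfolding cell by auto
      have "r = r'" by (rule ITD_uniq[OF A, of 0 "s + 2"]) (use r r' s in auto)
      thus ?thesis using r r' by simp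
    qed
    show "i = i'" if "L s i j = Some k \<and> L s i' j = Some k" for i i' j k
    proof -
      from that obtain r r' where r: "r \<in> I" "f r 0 = i" "f r 1 = j" "f r (s + 2) = k"
        and r': "r' \<in> I" "f r' 0 = i'" "f r' 1 = j" "f r' (s + 2) = k" unfolding cell by auto
      have "r = r'" by (rule ITD_uniq[OF A, of 1 "s + 2"]) (use r r' s in auto)
      thus ?thesis using r r' by simp
    qed
    show "L s i j \<noteq> Some k" if "k \<in> M" "i \<in> M \<or> j \<in> M" for i j k
    proof
      assume "L s i j = Some k"
      then obtain r where r: "r \<in> I" "f r 0 = i" "f r 1 = j" "f r (s + 2) = k" unfolding cell by auto
      show False using that ITD_mem[OF A r(1), of 0 "s + 2"] ITD_mem[OF A r(1), of 1 "s + 2"] r s by auto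
    qed
  qed
  have orth: "{(a, b). \<exists>i\<in>{1..n}. \<exists>j\<in>{1..n}. \<not> {i, j} \<subseteq> M \<and> L s i j = Some a \<and> L s' i j = Some b}
       = {1..n} \<times> {1..n} - M \<times> M" if s: "s < t" "s' < t" "s \<noteq> s'" for s s'
    unfolding X_def[symmetric]
  proof (intro equalityI subsetI, goal_cases)
    case (1 p)
    then obtain a b i j where p: "p = (a, b)" "L s i j = Some a" "L s' i j = Some b" by auto
    obtain r where r: "r \<in> I" "f r 0 = i" "f r 1 = j" "f r (s + 2) = a" using p(2) unfolding cell by auto
    obtain r' where r': "r' \<in> I" "f r' 0 = i" "f r' 1 = j" "f r' (s' + 2) = b" using p(3) unfolding cell by auto
    have "r = r'" by (rule ITD_uniq[OF A, of 0 1]) (use r r' in auto)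
    then show ?case using ITD_mem[OF A r(1), of "s + 2" "s' + 2"] r r' s p by auto
  next
    case (2 p)
    then obtain a b where p: "p = (a, b)" "(a, b) \<in> X \<times> X - M \<times> M" by auto
    obtain r where r: "r \<in> I" "f r (s + 2) = a" "f r (s' + 2) = b"
      using ITD_ex[OF A _ _ _ p(2), of "s + 2" "s' + 2"] s by auto
    have "L s (f r 0) (f r 1) = Some a" "L s' (f r 0) (f r 1) = Some b" unfolding cell using r by auto
    moreover have "(f r 0, f r 1) \<in> X \<times> X - M \<times> M" using ITD_mem[OF A r(1), of 0 1] by simp
    ultimately show ?case using p by auto
  qed
  have neq: "L s \<noteq> L s'" if s: "s < t" "s' < t" "s \<noteq> s'" for s s'
  proof
    assume eq: "L s = L s'"
    \<comment> \<open>A pair of distinct symbols outside the hole, which two equal squares could not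
      realise. Distinctness is needed because \<open>IMOLS\<close> counts a set of squares.\<close>
    have "(n, 1) \<in> {1..n} \<times> {1..n} - M \<times> M" using mn n2 by (auto simp: M_def)
    then obtain i j where "L s i j = Some n" "L s' i j = Some 1" unfolding orth[OF s, symmetric] by auto
    thus False using eq n2 by simp
  qed
  have "inj_on L {..<t}" using neq by (intro inj_onI) (metis lessThan_iff)
  hence "card (L ` {..<t}) = t" by (simp add: card_image)
  moreover have "orthogonal_ils n M (L s) (L s')" if "s < t" "s' < t" "L s \<noteq> L s'" for s s'
    unfolding orthogonal_ils_def by (rule orth) (use that in auto)
  ultimately have "IMOLS t n m (L ` {..<t})"
    unfolding IMOLS_def using ils by auto
  thus ?thesis by blast
qed

section \<open>Transversal designs from finite fields and residue rings\<close>

text \<open>Without a hole there are as many blocks as pairs of points, so counting yields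
  surjectivity from injectivity.\<close>

lemma ITD_if_inj:
  assumes "finite X" "finite I" "card I = card X * card X"
    and mem: "\<And>r i. r \<in> I \<Longrightarrow> i < k \<Longrightarrow> f r i \<in> X"
    and inj: "\<And>r s i j. i < k \<Longrightarrow> j < k \<Longrightarrow> i \<noteq> j \<Longrightarrow> r \<in> I \<Longrightarrow> s \<in> I \<Longrightarrow>
           f r i = f s i \<Longrightarrow> f r j = f s j \<Longrightarrow> r = s"
  shows "ITD k X {} I f"
  unfolding ITD_def
proof (intro allI impI)
  fix i j assume ij: "i < k" "j < k" "i \<noteq> j"
  let ?F = "\<lambda>r. (f r i, f r j)"
  have "inj_on ?F I" using inj[OF ij] by (intro inj_onI) simp
  moreover have "?F ` I = X \<times> X"
  proof (rule card_subset_eq)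
    show "card (?F ` I) = card (X \<times> X)"
      using \<open>inj_on ?F I\<close> assms(3) by (simp add: card_image card_cartesian_product)
  qed (use mem ij assms(1) in auto)
  ultimately show "bij_betw ?F I (X \<times> X - {} \<times> {})" by (simp add: bij_betw_def)
qed

text \<open>The first \<open>k - 1\<close> groups carry \<open>x + i * y\<close> modulo
  \<open>n\<close>, and the last one carries \<open>y\<close> as the slope at infinity. Distinct
  finite slopes differ by less than \<open>k\<close>, hence by a unit modulo
  \<open>n\<close>.\<close>

lemma itd_if_coprime:
  assumes k: "2 \<le> k" and n: "\<And>p. prime p \<Longrightarrow> p < k \<Longrightarrow> \<not> p dvd n" and n0: "0 < n"
  shows "itd k n 0"
proof -
  define f where "f = (\<lambda>(x, y) i. if i = k - 1 then y else (x + i * y) mod n)"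
  have f_simps: "f (x, y) (k - 1) = y" "i \<noteq> k - 1 \<Longrightarrow> f (x, y) i = (x + i * y) mod n" for x y i
    by (simp_all add: f_def)
  have cop: "coprime (int d) (int n)" if "0 < d" "d < k" for d
  proof (rule ccontr)
    assume "\<not> coprime (int d) (int n)"
    hence "gcd d n \<noteq> 1" by (simp add: coprime_iff_gcd_eq_1)
    then obtain p where p: "prime p" "p dvd gcd d n" using prime_factor_nat by blast
    hence "p \<le> d" using that by (auto intro: dvd_imp_le)
    thus False using n[OF p(1)] p(2) that by simp
  qed
  have xeq: "x = x'" if "(x + i * y) mod n = (x' + i * y) mod n" "x < n" "x' < n" for x x' y i :: nat
  proof -
    have "[x + i * y = x' + i * y] (mod n)" using that by (simp add: cong_def)
    thus ?thesis using that by (simp add: cong_add_rcancel_nat cong_less_modulus_unique_nat)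
  qed
  have yeq: "y = y'" if eq: "(x + i * y) mod n = (x' + i * y') mod n" "(x + j * y) mod n = (x' + j * y') mod n"
    and ij: "i < j" "j < k" and "y < n" "y' < n" for x x' y y' i j :: nat
  proof -
    have "int n dvd (int x + int i * int y) - (int x' + int i * int y')"
      using eq(1) by (metis (mono_tags) mod_eq_dvd_iff of_nat_add of_nat_mult zmod_int)
    moreover have "int n dvd (int x + int j * int y) - (int x' + int j * int y')"
      using eq(2) by (metis (mono_tags) mod_eq_dvd_iff of_nat_add of_nat_mult zmod_int)
    ultimately have "int n dvd ((int x + int j * int y) - (int x' + int j * int y'))
        - ((int x + int i * int y) - (int x' + int i * int y'))" by (rule dvd_diff[rotated])
    also have "\<dots> = int (j - i) * (int y - int y')" using ij by (simp add: algebra_simps of_nat_diff)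
    finally have "int n dvd int y - int y'"
      using cop[of "j - i"] ij by (simp add: coprime_dvd_mult_right_iff coprime_commute)
    hence "int y mod int n = int y' mod int n" by (simp add: mod_eq_dvd_iff)
    thus ?thesis using that by simp
  qed
  have "ITD k {..<n} {} ({..<n} \<times> {..<n}) f"
  proof (rule ITD_if_inj)
    show "f r i \<in> {..<n}" if "r \<in> {..<n} \<times> {..<n}" "i < k" for r i
      using that n0 by (auto simp: f_def)
  next
    fix r s i j assume ij: "i < k" "j < k" "i \<noteq> j" and rs: "r \<in> {..<n} \<times> {..<n}" "s \<in> {..<n} \<times> {..<n}"
      and eq: "f r i = f s i" "f r j = f s j"
    obtain x y where r: "r = (x, y)" "x < n" "y < n" using rs by auto
    obtain x' y' where s: "s = (x', y')" "x' < n" "y' < n" using rs by auto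
    have "y = y'"
    proof (cases "i = k - 1 \<or> j = k - 1")
      case True
      then show ?thesis using eq r s f_simps by auto
    next
      case False
      then have "(x + i * y) mod n = (x' + i * y') mod n" "(x + j * y) mod n = (x' + j * y') mod n"
        using eq r s f_simps by auto
      then show ?thesis using yeq[of x i y x' y' j] yeq[of x j y x' y' i] ij r s
        by (cases "i < j") auto
    qed
    moreover obtain l where "l < k" "l \<noteq> k - 1" "f r l = f s l"
      using ij eq by (cases "i = k - 1") auto
    ultimately show "r = s" using xeq[of x l y x'] r s f_simps(2)[of l] by auto
  qed (auto simp: card_cartesian_product)
  from itd_I[OF this] show ?thesis using k by simp
qed

text \<open>The same construction with \<open>k - 1\<close> distinct slopes \<open>e i\<close> from
  \<open>S\<close>. Cancellation takes place in the ambient field and surjectivity comes from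
  counting, so closure under sums and products suffices.\<close>

lemma itd_if_subfield:
  fixes S :: "'a :: field set"
  assumes "finite S" and add: "\<And>x y. x \<in> S \<Longrightarrow> y \<in> S \<Longrightarrow> x + y \<in> S"
    and mult: "\<And>x y. x \<in> S \<Longrightarrow> y \<in> S \<Longrightarrow> x * y \<in> S"
    and k: "2 \<le> k" "k \<le> card S + 1"
  shows "itd k (card S) 0"
proof -
  obtain e where e: "e ` {..<k - 1} \<subseteq> S" "inj_on e {..<k - 1}"
    using card_le_inj[of "{..<k - 1}" S] \<open>finite S\<close> k by fastforce
  define f where "f = (\<lambda>(x, y) i. if i = k - 1 then y else x + e i * y)"
  have f_simps: "f (x, y) (k - 1) = y" "i \<noteq> k - 1 \<Longrightarrow> f (x, y) i = x + e i * y" for x y i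
    by (simp_all add: f_def)
  have eS: "e i \<in> S" if "i < k" "i \<noteq> k - 1" for i using e(1) that by auto
  have "ITD k S {} (S \<times> S) f"
  proof (rule ITD_if_inj)
    show "f r i \<in> S" if "r \<in> S \<times> S" "i < k" for r i
      using that by (auto simp: f_def intro!: add mult eS)
  next
    fix r s i j assume ij: "i < k" "j < k" "i \<noteq> j" and rs: "r \<in> S \<times> S" "s \<in> S \<times> S"
      and eq: "f r i = f s i" "f r j = f s j"
    obtain x y where r: "r = (x, y)" by (cases r)
    obtain x' y' where s: "s = (x', y')" by (cases s)
    have "y = y'"
    proof (cases "i = k - 1 \<or> j = k - 1")
      case True
      then show ?thesis using eq r s f_simps by auto
    next
      case False
      then have 1: "x + e i * y = x' + e i * y'" "x + e j * y = x' + e j * y'"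
        using eq r s f_simps by auto
      have "(e i - e j) * (y - y') = (x + e i * y) - (x' + e i * y') - ((x + e j * y) - (x' + e j * y'))"
        by (simp add: algebra_simps)
      also have "\<dots> = 0" unfolding 1 by simp
      finally have "e i = e j \<or> y = y'" by simp
      moreover have "i < k - 1" "j < k - 1" using ij False by linarith+
      hence "e i \<noteq> e j" using inj_onD[OF e(2), of i j] ij(3) by auto
      ultimately show ?thesis by simp
    qed
    moreover obtain l where "l < k" "l \<noteq> k - 1" "f r l = f s l"
      using ij eq by (cases "i = k - 1") auto
    ultimately show "r = s" using r s f_simps(2)[of l] by auto
  qed (use \<open>finite S\<close> in \<open>auto simp: card_cartesian_product\<close>)
  from itd_I[OF this] show ?thesis using k \<open>finite S\<close> by simp
qed

section \<open>The fields of order 2^d inside the algebraic closure of GF(2)\<close>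

lemma bit_alg_closure_char_2: "(1 + 1 :: bit alg_closure) = 0"
proof -
  have "(1 + 1 :: bit alg_closure) = to_ac (1 + 1)" unfolding to_ac_add to_ac_1 ..
  also have "1 + 1 = (0 :: bit)" by simp
  finally show ?thesis by simp
qed

lemma add_power_two_power:
  fixes x y :: "bit alg_closure"
  shows "(x + y) ^ (2 ^ d) = x ^ (2 ^ d) + y ^ (2 ^ d)"
proof (induction d)
  case (Suc d)
  have "(x + y) ^ (2 ^ Suc d) = ((x + y) ^ (2 ^ d))\<^sup>2" by (simp add: power_mult mult.commute flip: power_mult)
  also have "\<dots> = (x ^ (2 ^ d))\<^sup>2 + (y ^ (2 ^ d))\<^sup>2 + (1 + 1) * (x ^ (2 ^ d) * y ^ (2 ^ d))"
    unfolding Suc by (simp add: power2_eq_square algebra_simps)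
  finally show ?case unfolding bit_alg_closure_char_2 by (simp add: mult.commute flip: power_mult)
qed simp

text \<open>These are the roots of X^(2^d) - X. Over the closure the polynomial splits, and its
  roots are simple because its derivative is the constant -1, so their number is the degree.\<close>

lemma card_two_power_roots:
  assumes "0 < d"
  shows "finite {a :: bit alg_closure. a ^ (2 ^ d) = a}" "card {a :: bit alg_closure. a ^ (2 ^ d) = a} = 2 ^ d"
proof -
  define p :: "bit alg_closure poly" where "p = monom 1 (2 ^ d) - monom 1 1"
  have d1: "1 < (2::nat) ^ d" using assms by (intro one_less_power) auto
  have deg: "degree p = 2 ^ d"
    unfolding p_def diff_conv_add_uminus by (subst degree_add_eq_left) (use d1 in \<open>auto simp: degree_monom_eq\<close>)
  have "p \<noteq> 0" using deg d1 by auto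
  have roots: "poly p a = 0 \<longleftrightarrow> a ^ (2 ^ d) = a" for a by (simp add: p_def poly_monom)
  show fin: "finite {a :: bit alg_closure. a ^ (2 ^ d) = a}"
    using poly_roots_finite[OF \<open>p \<noteq> 0\<close>] by (simp add: roots)
  have two: "(2 :: bit alg_closure) = 0" using bit_alg_closure_char_2 by simp
  have "pderiv p = - 1"
    unfolding p_def pderiv_diff pderiv_monom using assms two by (cases d) (auto simp: monom_0 one_pCons)
  obtain A where A: "size A = degree p" "p = smult (lead_coeff p) (\<Prod>x\<in>#A. [:-x, 1:])"
    using alg_closed_imp_factorization[OF \<open>p \<noteq> 0\<close>] by blast
  have "proots p = proots (\<Prod>x\<in>#A. [:-x, 1:])"
    using \<open>p \<noteq> 0\<close> by (subst A(2)) simp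
  also have "\<dots> = A"
  proof (induction A)
    case (add x A)
    have "(\<Prod>x\<in>#A. [:-x, 1:]) \<noteq> 0" by (auto simp: prod_mset_zero_iff)
    hence "proots ([:-x, 1:] * (\<Prod>x\<in>#A. [:-x, 1:])) = {#x#} + A"
      by (subst proots_mult) (simp_all add: add del: mult_pCons_left)
    thus ?case by (simp del: mult_pCons_left)
  qed simp
  finally have size: "size (proots p) = 2 ^ d" using A deg by simp
  have simple: "Polynomial.order a p = 1" if "a \<in># proots p" for a
  proof (rule ccontr)
    assume "Polynomial.order a p \<noteq> 1"
    moreover have "Polynomial.order a p \<noteq> 0" using that \<open>p \<noteq> 0\<close> by (simp add: order_root)
    ultimately have "[:- a, 1:] ^ 2 dvd p" by (intro power_le_dvd[OF order_1]) simp
    then obtain q where "p = [:- a, 1:] ^ 2 * q" by (elim dvdE)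
    hence p: "p = [:- a, 1:] * ([:- a, 1:] * q)" by (simp only: power2_eq_square mult.assoc)
    have "poly (pderiv p) a = 0"
      unfolding p pderiv_mult poly_add poly_mult by simp
    thus False using \<open>pderiv p = - 1\<close> by simp
  qed
  hence "size (proots p) = (\<Sum>a\<in>set_mset (proots p). 1)"
    unfolding size_multiset_overloaded_eq using \<open>p \<noteq> 0\<close> simple by (intro sum.cong) auto
  also have "\<dots> = card {a :: bit alg_closure. a ^ (2 ^ d) = a}" using \<open>p \<noteq> 0\<close> by (simp add: roots)
  finally show "card {a :: bit alg_closure. a ^ (2 ^ d) = a} = 2 ^ d" using size by simp
qed

lemma itd_two_power:
  assumes "2 \<le> k" "0 < d" "k \<le> 2 ^ d + 1"
  shows "itd k (2 ^ d) 0"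
proof -
  let ?S = "{a :: bit alg_closure. a ^ (2 ^ d) = a}"
  have "itd k (card ?S) 0"
    by (rule itd_if_subfield)
      (use assms card_two_power_roots in \<open>auto simp: add_power_two_power power_mult_distrib\<close>)
  thus ?thesis using card_two_power_roots assms by simp
qed

section \<open>Transversal designs of all large orders\<close>

lemma ex_cong_interval:
  fixes F a b :: nat
  assumes "0 < F"
  obtains g where "a \<le> g" "g < a + F" "[g = b] (mod F)"
proof
  \<comment> \<open>\<open>(F - 1) * a\<close> represents -a modulo \<open>F\<close> without leaving
    the natural numbers.\<close>
  let ?g = "a + (b + (F - 1) * a) mod F"
  show "a \<le> ?g" "?g < a + F" using assms by auto
  have "[?g = a + (b + (F - 1) * a)] (mod F)" by (simp add: cong_def mod_simps)
  also have "a + (b + (F - 1) * a) = b + F * a" using assms by (cases F) auto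
  also have "[b + F * a = b] (mod F)" by (simp add: cong_def)
  finally show "[?g = b] (mod F)" .
qed

text \<open>Inflation with weight 1 on \<open>u\<close> points of the last group and weight 0 on the
  others.\<close>

lemma itd_extend_by_1:
  assumes "itd (Suc k) g 0" "itd k m 0" "itd k (m + 1) 0" "u \<le> g" and k: "2 \<le> k"
  shows "itd k (m * g + u) u"
proof -
  have "itd k (m * g + (\<Sum>z<g. if z < u then 1 else 0)) (\<Sum>z<g. if z < u then 1 else 0)"
    by (rule itd_wilson) (use assms itd_hole_1[OF assms(3)] in auto)
  moreover have "(\<Sum>z<g. if z < u then 1 else 0) = card ({..<g} \<inter> {z. z < u})"
    by (simp add: sum.If_cases)
  moreover have "{..<g} \<inter> {z. z < u} = {..<u}" using assms(4) by auto
  ultimately show ?thesis by simp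
qed

lemma itd_if_odd:
  assumes k: "2 \<le> k" and n: "odd n" "\<And>p. prime p \<Longrightarrow> odd p \<Longrightarrow> p \<le> k \<Longrightarrow> \<not> p dvd n"
  shows "itd k n 0"
proof (rule itd_if_coprime[OF k])
  fix p :: nat assume p: "prime p" "p < k"
  show "\<not> p dvd n"
  proof (cases "p = 2")
    case False
    hence "odd p" using p prime_odd_nat[of p] prime_ge_2_nat[of p] by auto
    then show ?thesis using n(2)[of p] p by auto
  qed (use n in simp)
qed (use n in \<open>auto intro: Nat.gr0I\<close>)

text \<open>The congruence says that \<open>2 ^ a\<close> is the exact power of 2 in
  \<open>n\<close>. The field of that order handles this factor, residues handle the odd cofactor,
  and the product joins them.\<close>

lemma itd_two_power_times:
  assumes k: "2 \<le> k" and n: "[n = 2 ^ a] (mod 2 ^ Suc a)" and a: "0 < a" "k \<le> 2 ^ a + 1"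
    and p: "\<And>p. prime p \<Longrightarrow> odd p \<Longrightarrow> p \<le> k \<Longrightarrow> \<not> p dvd n"
  shows "itd k n 0"
proof -
  have "n mod 2 ^ Suc a = 2 ^ a" using n by (simp add: cong_def)
  hence "n = 2 ^ Suc a * (n div 2 ^ Suc a) + 2 ^ a"
    using div_mult_mod_eq[of n "2 ^ Suc a"] by (metis mult.commute)
  then obtain y where y: "n = 2 ^ a * y" "odd y"
    using that[of "2 * (n div 2 ^ Suc a) + 1"] by (simp add: algebra_simps)
  have "itd k y 0"
  proof (rule itd_if_odd[OF k y(2)])
    fix p :: nat assume "prime p" "odd p" "p \<le> k"
    with p have "\<not> p dvd 2 ^ a * y" unfolding y(1) by blast
    thus "\<not> p dvd y" by (rule contrapos_nn) simp
  qed
  hence "itd k (2 ^ a * y) (0 * y)" using itd_two_power[OF k a] k by (intro itd_product)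
  thus ?thesis using y by simp
qed

text \<open>Modulo a small odd prime, \<open>m\<close> and \<open>m + 1\<close> are 1 and 2, hence
  nonzero. Of the two numbers the odd one is covered by residues, and the even one is arranged to
  contain exactly the factor \<open>2 ^ k\<close>.\<close>

lemma ex_consecutive_itd:
  assumes k: "2 \<le> k"
  obtains m where "0 < m" "itd k m 0" "itd k (m + 1) 0" "even m \<longleftrightarrow> b"
    "\<And>p. prime p \<Longrightarrow> odd p \<Longrightarrow> p \<le> k \<Longrightarrow> [m = 1] (mod p)"
proof -
  have "k < 2 ^ k" by (rule less_exp)
  hence k2: "k \<le> 2 ^ k + 1" "0 < k" using k by linarith+
  define Ps where "Ps = {p::nat. prime p \<and> p \<le> k}"
  have fin: "finite Ps" by (rule finite_subset[of _ "{..k}"]) (auto simp: Ps_def)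
  \<comment> \<open>The modulus \<open>2 ^ Suc k\<close> at the prime 2 controls the exact power of
    2, and \<open>v\<close> assigns the factor \<open>2 ^ k\<close> to \<open>m\<close> or to
    \<open>m + 1\<close>.\<close>
  define M where "M p = (if p = 2 then 2 ^ Suc k else p)" for p :: nat
  define v :: nat where "v = (if b then 2 ^ k else 2 ^ k - 1)"
  define u where "u p = (if p = 2 then v else 1)" for p :: nat
  have "\<forall>p\<in>Ps. \<forall>q\<in>Ps. p \<noteq> q \<longrightarrow> coprime (M p) (M q)"
  proof (intro ballI impI)
    fix p q assume "p \<in> Ps" "q \<in> Ps" "p \<noteq> q"
    hence "coprime p q" by (intro primes_coprime) (auto simp: Ps_def)
    thus "coprime (M p) (M q)" using \<open>p \<noteq> q\<close> unfolding M_def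
      by (auto simp del: power_Suc)
  qed
  from chinese_remainder_nat[OF fin this, of u] obtain m where m: "\<forall>p\<in>Ps. [m = u p] (mod M p)" ..
  have "2 \<in> Ps" using k by (simp add: Ps_def)
  with m have m2: "[m = v] (mod 2 ^ Suc k)" by (force simp: u_def M_def)
  have mp: "[m = 1] (mod p)" if "prime p" "odd p" "p \<le> k" for p
  proof -
    have "p \<in> Ps" "p \<noteq> 2" using that by (auto simp: Ps_def)
    with m show ?thesis by (force simp: u_def M_def)
  qed
  have "2 dvd (2::nat) ^ Suc k" by simp
  hence "[m = v] (mod 2)" using m2 cong_dvd_modulus_nat by blast
  hence "even m \<longleftrightarrow> even v" by (rule cong_dvd_iff)
  hence par: "even m \<longleftrightarrow> b" using k2 by (simp add: v_def even_diff_nat)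
  have pm: "\<not> p dvd m" "\<not> p dvd m + 1" if "prime p" "odd p" "p \<le> k" for p
  proof -
    have p1: "\<not> p dvd 1" using prime_gt_1_nat[OF that(1)] by simp
    have "\<not> p dvd 2" using that by (metis dvd_refl primes_dvd_imp_eq two_is_prime_nat)
    moreover have "[m + 1 = 1 + 1] (mod p)" using mp[OF that] by (rule cong_add) simp
    ultimately show "\<not> p dvd m + 1" by (metis cong_dvd_iff one_add_one)
    show "\<not> p dvd m" using mp[OF that] p1 cong_dvd_iff by blast
  qed
  have "itd k m 0 \<and> itd k (m + 1) 0"
  proof (cases b)
    case True
    have "[m = 2 ^ k] (mod 2 ^ Suc k)" using m2 True by (simp add: v_def)
    with k2 pm(1) have "itd k m 0" by (intro itd_two_power_times[OF k]) auto
    moreover have "itd k (m + 1) 0" using pm(2) par True by (intro itd_if_odd[OF k]) auto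
    ultimately show ?thesis by simp
  next
    case False
    have "[m + 1 = 2 ^ k - 1 + 1] (mod 2 ^ Suc k)" using m2 False by (intro cong_add) (simp_all add: v_def)
    hence "[m + 1 = 2 ^ k] (mod 2 ^ Suc k)" by simp
    with k2 pm(2) have "itd k (m + 1) 0" by (intro itd_two_power_times[OF k]) auto
    moreover have "itd k m 0" using pm(1) par False by (intro itd_if_odd[OF k]) auto
    ultimately show ?thesis by simp
  qed
  moreover have "0 < m"
  proof (rule Nat.gr0I)
    assume "m = 0"
    have "1 < (2 :: nat) ^ k" using k2 by (intro one_less_power) auto
    hence "v < 2 ^ Suc k" "0 < v" by (auto simp: v_def)
    thus False using m2 \<open>m = 0\<close> by (simp add: cong_def)
  qed
  ultimately show ?thesis using that[of m] par mp by blast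
qed

text \<open>
  Choosing \<open>m\<close> to be congruent to \<open>1\<close> modulo every small odd prime leaves, for each such
  prime \<open>p\<close>, a residue class in which both \<open>g\<close> and \<open>n - m g\<close> are invertible: it must avoid
  the classes of \<open>0\<close> and \<open>n\<close> only.
\<close>
theorem eventually_itd_0:
  assumes k: "2 \<le> k"
  obtains N where "\<And>n. N \<le> n \<Longrightarrow> itd k n 0"
proof -
  \<comment> \<open>Both \<open>g\<close> and \<open>u = n - m * g\<close> have to be odd, so
    \<open>m\<close> must have the parity opposite to \<open>n\<close>; one \<open>m\<close> of each
    parity is prepared.\<close>
  obtain m1 where m1: "0 < m1" "itd k m1 0" "itd k (m1 + 1) 0" "even m1 \<longleftrightarrow> True"
    "\<And>p. prime p \<Longrightarrow> odd p \<Longrightarrow> p \<le> k \<Longrightarrow> [m1 = 1] (mod p)" using ex_consecutive_itd[OF k, of True] by blast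
  obtain m2 where m2: "0 < m2" "itd k m2 0" "itd k (m2 + 1) 0" "even m2 \<longleftrightarrow> False"
    "\<And>p. prime p \<Longrightarrow> odd p \<Longrightarrow> p \<le> k \<Longrightarrow> [m2 = 1] (mod p)" using ex_consecutive_itd[OF k, of False] by blast
  \<comment> \<open>The prime \<open>k\<close> itself is included if \<open>k\<close> is prime,
    since the design of order \<open>g\<close> has \<open>k + 1\<close> groups.\<close>
  define Ps where "Ps = {p::nat. prime p \<and> p \<le> k}"
  have fin: "finite Ps" by (rule finite_subset[of _ "{..k}"]) (auto simp: Ps_def)
  define F where "F = \<Prod>Ps"
  have F0: "0 < F" unfolding F_def by (rule prod_pos) (auto simp: Ps_def prime_gt_0_nat)
  define B where "B m = m * (m + 1) * (F + 1)" for m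
  have main: "itd k n 0" if n: "B m \<le> n" and par: "even m \<longleftrightarrow> odd n"
    and m: "0 < m" "itd k m 0" "itd k (m + 1) 0"
      "\<And>p. prime p \<Longrightarrow> odd p \<Longrightarrow> p \<le> k \<Longrightarrow> [m = 1] (mod p)" for n m
  proof -
    \<comment> \<open>Modulo an odd prime both 1 and 2 are nonzero, and the one chosen is not
      congruent to \<open>n\<close>. Modulo 2 only 1 is possible.\<close>
    define v where "v p = (if p = 2 then 1 else if [n = 1] (mod p) then 2 else 1 :: nat)" for p :: nat
    have "\<forall>p\<in>Ps. \<forall>q\<in>Ps. p \<noteq> q \<longrightarrow> coprime p q" by (auto simp: Ps_def intro: primes_coprime)
    from chinese_remainder_nat[OF fin this, of v] obtain \<gamma> where \<gamma>: "\<forall>p\<in>Ps. [\<gamma> = v p] (mod p)" ..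
    \<comment> \<open>Exceeding n / (m + 1) gives \<open>u <= g\<close>. The excess is bounded in
      terms of \<open>F\<close>, and \<open>B m <= n\<close> keeps \<open>m * g\<close> below
      \<open>n\<close>.\<close>
    obtain g where g: "n div (m + 1) + 1 \<le> g" "g < n div (m + 1) + 1 + F" "[g = \<gamma>] (mod F)"
      using ex_cong_interval[OF F0] .
    have gp: "[g = v p] (mod p)" if "prime p" "p \<le> k" for p
    proof -
      have "p \<in> Ps" using that by (simp add: Ps_def)
      hence "p dvd F" unfolding F_def using fin by (intro dvd_prodI)
      hence "[g = \<gamma>] (mod p)" using g(3) cong_dvd_modulus_nat by blast
      thus ?thesis using \<gamma> \<open>p \<in> Ps\<close> cong_trans by blast
    qed
    have two: "odd p" "\<not> p dvd 2" "\<not> p dvd 1" if "prime p" "p \<noteq> 2" for p :: nat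
      using that prime_odd_nat[of p] prime_ge_2_nat[of p]
      by (auto dest: dvd_imp_le)
    have "\<not> p dvd g" if p: "prime p" "p \<le> k" for p
    proof
      assume "p dvd g"
      hence "p dvd v p" using gp[OF p] cong_dvd_iff by blast
      thus False using two[OF p(1)] p by (auto simp: v_def split: if_splits)
    qed
    moreover have "0 < g" using g by simp
    ultimately have TDg: "itd (Suc k) g 0" using k by (intro itd_if_coprime) auto
    have "m * F + m \<le> n div (m + 1)"
      using n by (subst less_eq_div_iff_mult_less_eq) (simp_all add: B_def algebra_simps)
    moreover have "m * g \<le> m * (n div (m + 1) + F)" using g by (intro mult_left_mono) auto
    moreover have "(m + 1) * (n div (m + 1)) \<le> n" by (rule times_div_less_eq_dividend)
    ultimately have le: "m * g \<le> n" by (simp add: algebra_simps)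
    have "n < (m + 1) + (m + 1) * (n div (m + 1))" by (rule dividend_less_times_div) simp
    also have "\<dots> = (m + 1) * (n div (m + 1) + 1)" by simp
    also have "\<dots> \<le> (m + 1) * g" using g by (intro mult_left_mono) auto
    finally have "n < (m + 1) * g" .
    define u where "u = n - m * g"
    have nu: "n = m * g + u" using le by (simp add: u_def)
    have "u \<le> g" using \<open>n < (m + 1) * g\<close> nu by simp
    have up: "\<not> p dvd u" if p: "prime p" "p \<le> k" for p
    proof
      assume "p dvd u"
      hence n': "[n = m * g] (mod p)" unfolding nu by (auto simp: cong_def)
      show False
      proof (cases "p = 2")
        case True
        have "odd g" using gp[OF p] True by (simp add: v_def cong_def odd_iff_mod_2_eq_one)
        thus False using n' par True by (simp add: cong_def) (metis even_mult_iff even_iff_mod_2_eq_zero)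
      next
        case False
        have "[m * g = 1 * g] (mod p)" using m(4)[OF p(1) _ p(2)] two[OF p(1) False] cong_scalar_right by blast
        hence ng: "[n = v p] (mod p)" using n' gp[OF p] cong_trans by (metis mult_1)
        show False
        proof (cases "[n = 1] (mod p)")
          case True
          hence "[2 = 1] (mod p)" using ng False by (simp add: v_def) (metis cong_sym cong_trans)
          hence "p dvd 2 - 1" by (subst (asm) cong_altdef_nat) auto
          thus False using two[OF p(1) False] by simp
        next
          case f: False
          thus False using ng False by (simp add: v_def)
        qed
      qed
    qed
    have "0 < u" using up[of 2] k by (auto intro: Nat.gr0I)
    with up have "itd k u 0" using k by (intro itd_if_coprime) auto
    moreover have "itd k n u" unfolding nu by (rule itd_extend_by_1) (use TDg m \<open>u \<le> g\<close> k in auto)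
    ultimately show "itd k n 0" using itd_fill k by blast
  qed
  show ?thesis
  proof (rule that[of "max (B m1) (B m2)"])
    fix n assume "max (B m1) (B m2) \<le> n"
    then show "itd k n 0" using main[of m1 n] main[of m2 n] m1 m2 by (cases "even n") auto
  qed
qed

section \<open>Large holes\<close>

text \<open>
  Weights \<open>0\<close>, \<open>1\<close> and \<open>c\<close> on the last group produce every hole size \<open>h\<close> up to about
  \<open>c g\<close>. The weight \<open>c\<close> is what makes the ratio of order and hole as small as \<open>q\<close>.
\<close>

lemma itd_extend:
  assumes TD: "itd (Suc k) g 0" and c: "itd k c 0" "0 < c" and q: "itd k q 0" "2 \<le> q"
    and m: "itd k (c * (q - 1)) 0" "itd k (c * (q - 1) + 1) 0" and h: "h div c + c \<le> g" and k: "2 \<le> k"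
  shows "itd k (c * (q - 1) * g + h) h"
proof -
  \<comment> \<open>Division with remainder: \<open>h div c\<close> points of weight
    \<open>c\<close> and \<open>h mod c\<close> points of weight 1. As the remainder is less than
    \<open>c\<close>, the bound on \<open>g\<close> provides enough points.\<close>
  define w where "w z = (if z < h div c then c else if z < h div c + h mod c then 1 else 0)" for z
  \<comment> \<open>A hole of size 1 in a design of order \<open>q\<close>, inflated
    \<open>c\<close> times, gives order \<open>c * q\<close> with a hole of size
    \<open>c\<close>.\<close>
  have cq: "itd k (c * (q - 1) + c) c"
  proof -
    have "itd k (q * c) (1 * c)" using itd_hole_1[OF q(1)] q c k by (intro itd_product) auto
    moreover have "q * c = c * (q - 1) + c" using q by (cases q) auto
    ultimately show ?thesis by simp
  qed
  have "h mod c < c" using c by simp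
  hence "h div c + h mod c \<le> g" using h by simp
  hence "(\<Sum>z<g. w z) = (\<Sum>z<h div c. w z) + ((\<Sum>z=h div c..<h div c + h mod c. w z)
      + (\<Sum>z=h div c + h mod c..<g. w z))"
    by (simp add: lessThan_atLeast0 sum.atLeastLessThan_concat)
  also have "(\<Sum>z<h div c. w z) = h div c * c" by (simp add: w_def)
  also have "(\<Sum>z=h div c..<h div c + h mod c. w z) = h mod c" by (simp add: w_def)
  also have "(\<Sum>z=h div c + h mod c..<g. w z) = 0" by (simp add: w_def)
  finally have sum: "(\<Sum>z<g. w z) = h" by simp
  have "itd k (c * (q - 1) * g + (\<Sum>z<g. w z)) (\<Sum>z<g. w z)"
    by (rule itd_wilson[OF TD _ k]) (use cq m itd_hole_1[OF m(2)] k in \<open>auto simp: w_def\<close>)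
  thus ?thesis unfolding sum .
qed

section \<open>Two coprime moduli and the intermediate order\<close>

lemma ex_two_power_between:
  assumes "2 \<le> K"
  obtains f where "0 < f" "K \<le> 2 ^ f" "2 ^ f < 2 * (K::nat)"
proof -
  define f where "f = (LEAST f. K \<le> 2 ^ f)"
  have ge: "K \<le> 2 ^ f" unfolding f_def by (rule LeastI[of _ K]) (simp add: less_exp less_imp_le)
  have "f \<noteq> 0" using ge assms by (cases f) auto
  then obtain e where e: "f = Suc e" by (cases f) auto
  have "\<not> K \<le> 2 ^ e" using not_less_Least[of e "\<lambda>f. K \<le> 2 ^ f"] e by (simp add: f_def)
  thus ?thesis using that[of f] ge e by auto
qed

theorem theorem1p1:
  fixes t :: nat
  assumes "t > 0"
  shows "\<exists>N::nat. \<forall>n m :: nat. n \<ge> N \<and> m \<ge> N \<and> n \<ge> 8 * (t + 1)^2 * m \<longrightarrow> (\<exists>S. IMOLS t n m S)"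
proof -
  define K where "K = t + 1"
  define k where "k = t + 2"
  have k: "2 \<le> k" "k = K + 1" and K: "2 \<le> K" using assms by (auto simp: k_def K_def)
  obtain f where f: "0 < f" "K \<le> 2 ^ f" "2 ^ f < 2 * K" using ex_two_power_between[OF K] .
  define q :: nat where "q = 2 ^ f"
  have q: "K \<le> q" "q \<le> 2 * K - 1" "even q" using f by (auto simp: q_def)
  have TDq: "itd k q 0" unfolding q_def using f k by (intro itd_two_power) auto
  have "itd k (2 ^ Suc f) 0" using f k by (intro itd_two_power) auto
  hence TDq2: "itd k (2 * q) 0" by (simp add: q_def)
  obtain n1 where n1: "\<And>n. n1 \<le> n \<Longrightarrow> itd k n 0" using eventually_itd_0[OF k(1)] by blast
  obtain n2 where n2: "\<And>n. n2 \<le> n \<Longrightarrow> itd (Suc k) n 0" using eventually_itd_0[of "Suc k"] k by auto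
  \<comment> \<open>A power of 2 is coprime to the odd number \<open>2 * q - 1\<close>, and
    \<open>c >= n1\<close> makes the orders \<open>c\<close>, \<open>m1\<close> and
    \<open>m1 + 1\<close> available.\<close>
  define c :: nat where "c = 2 ^ n1"
  define m1 where "m1 = c * (q - 1)"
  \<comment> \<open>Coprime to \<open>m1\<close> and at least \<open>n1\<close>, so it can replace
    \<open>c\<close> in the extension with \<open>2 * q\<close>.\<close>
  define d where "d = m1 + 1"
  define m2 where "m2 = d * (2 * q - 1)"
  have c: "n1 \<le> c" "0 < c" by (simp_all add: c_def less_exp less_imp_le)
  have "c * 1 \<le> m1" unfolding m1_def using q K by (intro mult_left_mono) auto
  hence m1: "n1 \<le> m1" "0 < m1" using c by auto
  have d: "n1 \<le> d" "0 < d" using m1 by (auto simp: d_def)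
  have "d * 1 \<le> m2" unfolding m2_def using q K by (intro mult_left_mono) auto
  hence m2: "n1 \<le> m2" "0 < m2" using d by auto
  have "coprime m1 m2"
  proof -
    have "coprime m1 d" by (simp add: d_def)
    moreover have "2 * q - 1 = 2 * (q - 1) + 1" using q K by simp
    hence "coprime (q - 1) (2 * q - 1)" by (metis coprime_add_one_right coprime_mult_left_iff)
    moreover have "coprime c (2 * q - 1)" using q K by (simp add: c_def)
    ultimately show ?thesis by (simp add: m1_def m2_def)
  qed
  have step1: "itd k (m1 * g + h) h" if "n2 \<le> g" "h div c + c \<le> g" for g h
    unfolding m1_def by (rule itd_extend) (use that n1 n2 c m1 TDq q K k in \<open>auto simp: m1_def\<close>)
  have step2: "itd k (m2 * g + h) h" if "n2 \<le> g" "h div d + d \<le> g" for g h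
    unfolding m2_def by (rule itd_extend) (use that n1 n2 d m2 TDq2 q K k in \<open>auto simp: m2_def\<close>)
  \<comment> \<open>\<open>C\<close> bounds the excess of the intermediate order \<open>h1\<close>
    over \<open>2 * q * h\<close>; \<open>N\<close> collects the constant losses of both
    extensions.\<close>
  define C where "C = m2 * (d + n2) + m1 * m2"
  define N where "N = q * C + m1 * (c + n2) + 2"
  have "\<exists>S. IMOLS t n h S" if n: "N \<le> n" and h: "N \<le> h" and nh: "8 * K\<^sup>2 * h \<le> n" for n h
  proof -
    obtain x where x: "[x = n] (mod m1)" "[x = h] (mod m2)"
      using binary_chinese_remainder_nat[OF \<open>coprime m1 m2\<close>] by blast
    \<comment> \<open>The lower bound makes the quotient of \<open>h1 - h\<close> by
      \<open>m2\<close> large enough for \<open>step2\<close>, and the window is long enough to meet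
      the residue class of \<open>x\<close>.\<close>
    obtain h1 where h1: "h + m2 * (h div d + d + n2) \<le> h1"
        "h1 < h + m2 * (h div d + d + n2) + m1 * m2" "[h1 = x] (mod m1 * m2)"
      using ex_cong_interval[of "m1 * m2"] m1 m2 by (metis nat_0_less_mult_iff)
    have cong: "[h1 = n] (mod m1)" "[h1 = h] (mod m2)"
      using h1(3) x cong_trans cong_modulus_mult_nat by (blast, metis mult.commute)
    have "h \<le> h1" using h1 by simp
    hence "m2 dvd h1 - h" using cong(2) by (simp add: cong_altdef_nat)
    then obtain g2 where "h1 - h = m2 * g2" by (elim dvdE)
    hence g2: "h1 = m2 * g2 + h" using \<open>h \<le> h1\<close> by simp
    hence "m2 * (h div d + d + n2) \<le> m2 * g2" using h1 by simp
    hence "h div d + d + n2 \<le> g2" using m2 by simp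
    hence A: "itd k h1 h" unfolding g2 by (intro step2) auto
    \<comment> \<open>Up to constants the extension from \<open>h\<close> to \<open>h1\<close> costs
      the factor \<open>2 * q\<close>; likewise the one from \<open>h1\<close> to \<open>n\<close>
      costs the factor \<open>q\<close>.\<close>
    have "m2 * (h div d) = (2 * q - 1) * (d * (h div d))" by (simp add: m2_def)
    also have "\<dots> \<le> (2 * q - 1) * h" by (intro mult_left_mono) auto
    also have "(2 * q - 1) * h = 2 * q * h - h" by (simp add: diff_mult_distrib)
    finally have "m2 * (h div d) \<le> 2 * q * h - h" .
    moreover have "1 * h \<le> 2 * q * h" using q K by (intro mult_right_mono) auto
    ultimately have "h + m2 * (h div d) \<le> 2 * q * h" by linarith
    hence h1le: "h1 \<le> 2 * q * h + C" using h1 by (simp add: C_def algebra_simps)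
    have "m1 * (h1 div c) = (q - 1) * (c * (h1 div c))" by (simp add: m1_def)
    also have "\<dots> \<le> (q - 1) * h1" by (intro mult_left_mono) auto
    also have "(q - 1) * h1 = q * h1 - h1" by (simp add: diff_mult_distrib)
    finally have "m1 * (h1 div c) \<le> q * h1 - h1" .
    moreover have "1 * h1 \<le> q * h1" using q K by (intro mult_right_mono) auto
    ultimately have "h1 + m1 * (h1 div c) \<le> q * h1" by linarith
    also have "\<dots> \<le> q * (2 * q * h + C)" using h1le by simp
    finally have 1: "h1 + m1 * (h1 div c + c + n2) \<le> 2 * q\<^sup>2 * h + N"
      by (simp add: N_def algebra_simps power2_eq_square)
    \<comment> \<open>Since \<open>q <= 2 * K - 1\<close>, the ratio leaves a surplus of at least
      one \<open>h\<close>, which absorbs \<open>N\<close> because \<open>N <= h\<close>.\<close>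
    have "2 * q\<^sup>2 + 1 \<le> 8 * K\<^sup>2"
    proof -
      obtain L where L: "K = Suc L" using K by (cases K) auto
      have "q\<^sup>2 \<le> (2 * L + 1)\<^sup>2" using q L by (intro power_mono) auto
      thus ?thesis by (simp add: L power2_eq_square)
    qed
    hence "(2 * q\<^sup>2 + 1) * h \<le> 8 * K\<^sup>2 * h" by (rule mult_right_mono) simp
    hence "2 * q\<^sup>2 * h + N \<le> n" using nh h by (simp add: algebra_simps)
    with 1 have 2: "h1 + m1 * (h1 div c + c + n2) \<le> n" by simp
    hence "h1 \<le> n" by simp
    hence "m1 dvd n - h1" using cong_sym[OF cong(1)] by (simp add: cong_altdef_nat)
    then obtain g1 where "n - h1 = m1 * g1" by (elim dvdE)
    hence g1: "n = m1 * g1 + h1" using \<open>h1 \<le> n\<close> by simp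
    hence "m1 * (h1 div c + c + n2) \<le> m1 * g1" using 2 by simp
    hence "h1 div c + c + n2 \<le> g1" using m1 by simp
    hence "itd k n h1" unfolding g1 by (intro step1) auto
    hence "itd (t + 2) n h" using A k unfolding k_def[symmetric] by (blast intro: itd_fill)
    moreover have "h < n"
    proof -
      have "1 \<le> m1 * (h1 div c + c + n2)" using m1 c by simp
      thus ?thesis using 2 \<open>h \<le> h1\<close> by linarith
    qed
    moreover have "2 \<le> n" using n by (simp add: N_def)
    ultimately show ?thesis by (rule IMOLS_if_itd)
  qed
  thus ?thesis unfolding K_def by blast
qed

end
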